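(* Let $\mathcal{Y}=\{0;1\}$ and let the loss be $\ell(y,y')=\mathbf{1}_{y\ne y'}$. Let $L\in[0;1/2]$, $n\in\mathbb{N}$ and $\mathcal{G}$ be a set of prediction functions of VC-dimension $V\ge2$. Consider the set $\mathcal{P}_L$ of probability distributions on $\mathcal{X}\times\{0;1\}$ such that $\inf_{g\in\mathcal{G}}R(g)=L$. For any estimator $\hat g$: - when $L=0$, there exists $\mathbb{P}\in\mathcal{P}_0$ for which $$\mathbb{E}R(\hat g)-\inf_{g\in\mathcal{G}}R(g)\ge\begin{cases}\frac{V-1}{2e(n+1)},&\text{when }n\ge V-2,\\ \frac12\left(1-\frac1V\right)^n,&\text{otherwise;}\end{cases}$$ - when $0<L\le1/2$, there exists $\mathbb{P}\in\mathcal{P}_L$ for which $$\mathbb{E}R(\hat g)-\inf_{g\in\mathcal{G}}R(g)\ge\begin{cases}\sqrt{\frac{L(V-1)}{32n}}\vee\frac{2(V-1)}{27n},&\text{when }\frac{(1-2L)^2n}{V}\ge\frac49,\\ \frac{1-2L}{6},&\text{otherwise;}\end{cases}$$ - there exists a probability distribution for which $$\mathbb{E}R(\hat g)-\inf_{g\in\mathcal{G}}R(g)\ge\frac18\sqrt{\frac Vn}.$$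
   Context: Prediction functions are (measurable) functions $\mathcal{X}\to\{0;1\}$. For a distribution $\mathbb{P}$ on $\mathcal{X}\times\{0;1\}$, $R(g)=\mathbb{P}[Y\ne g(X)]$. An estimator $\hat g$ maps a training set $Z_1^n\in(\mathcal{X}\times\{0;1\})^n$ of size $n$ to a prediction function $\hat g_{Z_1^n}$ (not necessarily in $\mathcal{G}$); $\mathbb{E}R(\hat g)=\mathbb{E}_{Z_1^n\sim\mathbb{P}^{\otimes n}}R(\hat g_{Z_1^n})$, where $\mathbb{P}^{\otimes n}$ is the $n$-fold product of $\mathbb{P}$. $a\vee b=\max(a,b)$. Measurability of the manipulated quantities is implicitly assumed.
   Formalization: The third bound is stated only for V ≤ 13n (so n ≥ 1): as printed it is undefined at n = 0 and false for V > 16n, since the constant estimator equal to Y_1 can have excess risk at most 1/2; a thin range just above 13n where it still holds is left out. *)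

theory Defs
  imports "HOL-Probability.Probability" "HOL-Library.Extended_Nat"
begin

text \<open>
  The input space is an arbitrary measurable space, represented by a \<^typ>\<open>'a measure\<close>
  \<open>M\<close> of which only \<open>space M\<close> and \<open>sets M\<close> matter.
  The label set \<open>{0;1}\<close> is the type \<^typ>\<open>bool\<close> with the discrete sigma-algebra.
\<close>

definition labelled_space :: "'a measure \<Rightarrow> ('a \<times> bool) measure" where
  "labelled_space M = M \<Otimes>\<^sub>M count_space UNIV"

definition prediction_functions :: "'a measure \<Rightarrow> ('a \<Rightarrow> bool) set" where
  "prediction_functions M = measurable M (count_space UNIV)"

definition distributions :: "'a measure \<Rightarrow> ('a \<times> bool) measure set" where
  "distributions M = {P. prob_space P \<and> sets P = sets (labelled_space M)}"

definition risk :: "('a \<times> bool) measure \<Rightarrow> ('a \<Rightarrow> bool) \<Rightarrow> real" where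
  "risk P g = measure P {(x, y) \<in> space P. y \<noteq> g x}"

definition distributions_with_inf_risk ::
    "'a measure \<Rightarrow> ('a \<Rightarrow> bool) set \<Rightarrow> real \<Rightarrow> ('a \<times> bool) measure set" where
  "distributions_with_inf_risk M G L = {P \<in> distributions M. (INF g\<in>G. risk P g) = L}"

definition shatters :: "('a \<Rightarrow> bool) set \<Rightarrow> 'a set \<Rightarrow> bool" where
  "shatters G A \<longleftrightarrow> (\<forall>B\<subseteq>A. \<exists>g\<in>G. {x\<in>A. g x} = B)"

definition vc_dim :: "'a set \<Rightarrow> ('a \<Rightarrow> bool) set \<Rightarrow> enat" where
  "vc_dim X G = Sup {enat (card A) | A. A \<subseteq> X \<and> finite A \<and> shatters G A}"

text \<open>
  A training set of size \<open>n\<close> is a point of the \<open>n\<close>-fold product space, indexed by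
  \<open>{..<n}\<close>. The second conjunct of \<open>estimator\<close> is exactly the measurability
  needed for the expected risk below to make sense under every data distribution; it
  follows from joint measurability of \<open>(z, x) \<mapsto> ghat z x\<close>.
\<close>

definition estimator ::
    "'a measure \<Rightarrow> nat \<Rightarrow> ((nat \<Rightarrow> 'a \<times> bool) \<Rightarrow> 'a \<Rightarrow> bool) \<Rightarrow> bool" where
  "estimator M n ghat \<longleftrightarrow>
     (\<forall>z \<in> space (PiM {..<n} (\<lambda>_. labelled_space M)). ghat z \<in> prediction_functions M) \<and>
     (\<forall>P \<in> distributions M.
        (\<lambda>z. risk P (ghat z)) \<in> borel_measurable (PiM {..<n} (\<lambda>_. labelled_space M)))"

definition expected_risk ::
    "('a \<times> bool) measure \<Rightarrow> nat \<Rightarrow> ((nat \<Rightarrow> 'a \<times> bool) \<Rightarrow> 'a \<Rightarrow> bool) \<Rightarrow> real" where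
  "expected_risk P n ghat = (LINT z | PiM {..<n} (\<lambda>_. P). risk P (ghat z))"

definition excess_risk ::
    "('a \<Rightarrow> bool) set \<Rightarrow> ('a \<times> bool) measure \<Rightarrow> nat \<Rightarrow>
     ((nat \<Rightarrow> 'a \<times> bool) \<Rightarrow> 'a \<Rightarrow> bool) \<Rightarrow> real" where
  "excess_risk G P n ghat = expected_risk P n ghat - (INF g\<in>G. risk P g)"

end

theory Submission imports Defs begin

text \<open>
  The distributions live on a set \<open>A\<close> of \<open>V\<close> shattered points. The marginal weights \<open>u\<close> and
  noise rates \<open>\<eta>\<close> are fixed, and only the labelling \<open>B \<subseteq> A\<close> varies. Shattering makes the infimum
  of the risk equal to the noise level \<open>\<Sum> u \<eta>\<close>, and the excess risk is a weighted sum over the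
  points of the probabilities of mislabelling them. Averaging over all labellings and pairing
  \<open>B\<close> with the labelling that differs from it at \<open>x\<close> only, the two errors at \<open>x\<close> add up to at least
  the overlap \<open>\<Sum> min\<close> of the two sample laws. With \<open>\<xi> = 1 - 2 \<eta>\<close>, this overlap is at least
  \<open>(1 - u)^n\<close> (the sample may miss \<open>x\<close>) and at least \<open>1 - \<xi> \<surd>(n u)\<close> (a Hellinger-type argument).
  The stated bounds come from uniform weights, or from one heavy point and \<open>V - 1\<close> light ones,
  with optimised weight and noise.
\<close>

section \<open>Finitely supported distributions on an arbitrary measurable space\<close>

text \<open>
  The carrier of \<^term>\<open>measure_pmf p\<close> is the whole type, so it has to be mapped into the
  space of \<open>N\<close>; the fallback value is irrelevant when the support of \<open>p\<close> lies in that space. No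
  singleton needs to be measurable.
\<close>

definition pmf_on :: "'b measure \<Rightarrow> 'b pmf \<Rightarrow> 'b measure" where
  "pmf_on N p = distr (measure_pmf p) N (\<lambda>x. if x \<in> space N then x else SOME s. s \<in> set_pmf p)"

lemma sets_pmf_on [simp]: "sets (pmf_on N p) = sets N"
  by (simp add: pmf_on_def)

lemma space_pmf_on [simp]: "space (pmf_on N p) = space N"
  by (simp add: pmf_on_def)

lemma pmf_on_measurable:
  assumes "set_pmf p \<subseteq> space N"
  shows "(\<lambda>x. if x \<in> space N then x else SOME s. s \<in> set_pmf p) \<in> measurable (measure_pmf p) N"
proof -
  have "(SOME s. s \<in> set_pmf p) \<in> set_pmf p"
    using set_pmf_not_empty[of p] by (simp add: some_in_eq)
  then show ?thesis using assms by (auto simp: measurable_def)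
qed

lemma emeasure_pmf_on:
  assumes "set_pmf p \<subseteq> space N" "B \<in> sets N"
  shows "emeasure (pmf_on N p) B = emeasure (measure_pmf p) B"
  unfolding pmf_on_def
  using assms
  by (subst emeasure_distr[OF pmf_on_measurable])
     (auto intro!: emeasure_eq_AE simp: AE_measure_pmf_iff split: if_splits)

lemma measure_pmf_on:
  assumes "set_pmf p \<subseteq> space N" "B \<in> sets N"
  shows "measure (pmf_on N p) B = measure_pmf.prob p B"
  using emeasure_pmf_on[OF assms] by (simp add: measure_def)

lemma prob_space_pmf_on:
  assumes "set_pmf p \<subseteq> space N"
  shows "prob_space (pmf_on N p)"
  unfolding pmf_on_def by (intro measure_pmf.prob_space_distr pmf_on_measurable assms)

lemma integral_pmf_on:
  fixes f :: "'b \<Rightarrow> real"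
  assumes "set_pmf p \<subseteq> S" "finite S" "S \<subseteq> space N" "f \<in> borel_measurable N"
  shows "(LINT x|pmf_on N p. f x) = (\<Sum>x\<in>S. pmf p x * f x)"
proof -
  have sub: "set_pmf p \<subseteq> space N" using assms by blast
  have "(LINT x|pmf_on N p. f x)
      = (LINT x|measure_pmf p. f (if x \<in> space N then x else SOME s. s \<in> set_pmf p))"
    unfolding pmf_on_def by (rule integral_distr[OF pmf_on_measurable[OF sub] assms(4)])
  also have "\<dots> = (LINT x|measure_pmf p. f x)"
    using sub by (intro integral_cong_AE) (auto simp: AE_measure_pmf_iff)
  also have "\<dots> = (\<Sum>x\<in>S. f x * pmf p x)"
    using assms(1,2) by (intro integral_measure_pmf_real) auto
  finally show ?thesis by (simp add: mult.commute)
qed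

lemma PiE_dflt_undefined: "PiE_dflt I undefined B = PiE I B"
  by (auto simp: PiE_dflt_def PiE_iff extensional_def)

text \<open>Both measures agree on rectangles, which determines a product measure. The default value
  \<open>undefined\<close> of \<open>Pi_pmf\<close> makes its samples extensional, hence points of
  the product space.\<close>

lemma PiM_pmf_on:
  assumes "finite I" "set_pmf p \<subseteq> space N"
  shows "PiM I (\<lambda>_. pmf_on N p) = pmf_on (PiM I (\<lambda>_. N)) (Pi_pmf I undefined (\<lambda>_. p))"
proof -
  interpret prob_space "pmf_on N p" by (rule prob_space_pmf_on[OF assms(2)])
  interpret product_sigma_finite "\<lambda>_. pmf_on N p" by standard
  have sub: "set_pmf (Pi_pmf I undefined (\<lambda>_. p)) \<subseteq> space (PiM I (\<lambda>_. N))"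
    using assms by (auto simp: set_Pi_pmf PiE_dflt_undefined space_PiM PiE_iff)
  show ?thesis
  proof (rule PiM_eqI[symmetric])
    show "sets (pmf_on (PiM I (\<lambda>_. N)) (Pi_pmf I undefined (\<lambda>_. p))) = sets (PiM I (\<lambda>_. pmf_on N p))"
      by (simp cong: sets_PiM_cong)
    fix B assume "\<And>i. i \<in> I \<Longrightarrow> B i \<in> sets (pmf_on N p)"
    then have B: "B i \<in> sets N" if "i \<in> I" for i using that by simp
    then have "PiE I B \<in> sets (PiM I (\<lambda>_. N))"
      using assms(1) by (intro sets_PiM_I_finite) auto
    then have "emeasure (pmf_on (PiM I (\<lambda>_. N)) (Pi_pmf I undefined (\<lambda>_. p))) (PiE I B)
        = ennreal (measure_pmf.prob (Pi_pmf I undefined (\<lambda>_. p)) (PiE_dflt I undefined B))"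
      by (simp add: emeasure_pmf_on[OF sub] PiE_dflt_undefined measure_pmf.emeasure_eq_measure)
    also have "\<dots> = (\<Prod>i\<in>I. ennreal (measure_pmf.prob p (B i)))"
      using assms(1) by (simp add: measure_Pi_pmf_PiE_dflt prod_ennreal)
    also have "\<dots> = (\<Prod>i\<in>I. emeasure (pmf_on N p) (B i))"
      using B by (simp add: emeasure_pmf_on[OF assms(2)] measure_pmf.emeasure_eq_measure)
    finally show "emeasure (pmf_on (PiM I (\<lambda>_. N)) (Pi_pmf I undefined (\<lambda>_. p))) (PiE I B)
        = (\<Prod>i\<in>I. emeasure (pmf_on N p) (B i))" .
  qed (rule assms(1))
qed

text \<open>This turns an expected risk into a finite sum over samples of points of
  \<open>S\<close>, even if singletons are not measurable.\<close>

lemma integral_PiM_pmf_on: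
  fixes f :: "('i \<Rightarrow> 'b) \<Rightarrow> real"
  assumes "finite I" "set_pmf p \<subseteq> S" "finite S" "S \<subseteq> space N"
    and "f \<in> borel_measurable (PiM I (\<lambda>_. N))"
  shows "(LINT z|PiM I (\<lambda>_. pmf_on N p). f z)
      = (\<Sum>z\<in>(PiE I (\<lambda>_. S)). (\<Prod>i\<in>I. pmf p (z i)) * f z)"
proof -
  have "set_pmf (Pi_pmf I undefined (\<lambda>_. p)) \<subseteq> PiE I (\<lambda>_. S)"
    using assms by (auto simp: set_Pi_pmf PiE_dflt_undefined PiE_iff)
  moreover have "PiE I (\<lambda>_. S) \<subseteq> space (PiM I (\<lambda>_. N))"
    using assms by (auto simp: space_PiM PiE_iff)
  ultimately have "(LINT z|PiM I (\<lambda>_. pmf_on N p). f z)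
      = (\<Sum>z\<in>(PiE I (\<lambda>_. S)). pmf (Pi_pmf I undefined (\<lambda>_. p)) z * f z)"
    using assms by (subst PiM_pmf_on) (auto intro!: integral_pmf_on finite_PiE)
  also have "\<dots> = (\<Sum>z\<in>(PiE I (\<lambda>_. S)). (\<Prod>i\<in>I. pmf p (z i)) * f z)"
    using assms(1) by (intro sum.cong refl) (auto simp: pmf_Pi PiE_iff extensional_def)
  finally show ?thesis .
qed

section \<open>Overlap of two product laws\<close>

text \<open>
  A linearised Cauchy-Schwarz inequality. The right-hand side is a combination of products over
  the sample when \<open>P\<close>, \<open>Q\<close> and \<open>t\<close> are. Taking \<open>t\<close> to be the conditional affinity given the inputs
  gives a sharper bound than the Hellinger distance between the full sample laws, whose constant
  would be too weak.
\<close>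

lemma min_ge_affinity:
  fixes P Q s t :: real
  assumes "P \<ge> 0" "Q \<ge> 0" "s > 0"
  shows "min P Q \<ge> (1 - s/2 - 1/(2 * s)) * ((P + Q)/2) - t\<^sup>2 * ((P + Q)/2) / (2 * s) + t * sqrt (P*Q) / s"
proof -
  define a b d where "a = sqrt (P*Q)" and "b = (P+Q)/2" and "d = \<bar>P - Q\<bar>/2"
  have d2: "d\<^sup>2 = b\<^sup>2 - a\<^sup>2"
    using assms by (simp add: a_def b_def d_def power_divide power2_eq_square field_simps)
  have b0: "b \<ge> 0" using assms by (simp add: b_def)
  have mn: "min P Q = b - d" by (auto simp: b_def d_def min_def abs_if field_simps)
  have key: "2 * s*d \<le> s\<^sup>2*b + b + t\<^sup>2*b - 2*t*a"
  proof (cases "b = 0")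
    case True
    then have "P = 0" "Q = 0" using assms by (auto simp: b_def)
    then show ?thesis by (simp add: a_def b_def d_def)
  next
    case False
    \<comment> \<open>Since \<open>a\<^sup>2 + d\<^sup>2 = b\<^sup>2\<close>, expanding the squares
      leaves a common factor \<open>b\<close>, which is then cancelled.\<close>
    have "0 \<le> (s*b - d)\<^sup>2 + (a - t*b)\<^sup>2" by simp
    then have "(2 * s*d)*b \<le> (s\<^sup>2*b + b + t\<^sup>2*b - 2*t*a)*b"
      using d2 by (simp add: power2_eq_square algebra_simps)
    then show ?thesis using False b0 by (simp add: mult_le_cancel_right)
  qed
  have "d \<le> (s\<^sup>2*b + b + t\<^sup>2*b - 2*t*a) / (2 * s)"
    using key assms(3) by (simp add: field_simps)
  also have "\<dots> = s/2 * b + 1/(2 * s) * b + t\<^sup>2 * b / (2 * s) - t * a / s"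
    using assms(3) by (simp add: field_simps power2_eq_square)
  finally have "d \<le> s/2 * b + 1/(2 * s) * b + t\<^sup>2 * b / (2 * s) - t * a / s" .
  then have "b - d \<ge> (1 - s/2 - 1/(2 * s)) * b - t\<^sup>2 * b / (2 * s) + t * a / s"
    by (simp only: left_diff_distrib)
  then show ?thesis unfolding mn by (simp add: a_def b_def)
qed

lemma sum_PiE_prod_power:
  fixes f :: "'b \<Rightarrow> real"
  assumes "finite S"
  shows "(\<Sum>z\<in>(PiE {..<n::nat} (\<lambda>_. S)). \<Prod>i<n. f (z i)) = (\<Sum>s\<in>S. f s) ^ n"
  using prod_sum_PiE[of "{..<n}" "\<lambda>_. S" "\<lambda>_. f"] assms by simp

text \<open>Intended reading: \<open>p\<close> and \<open>q\<close> are the laws of one observation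
  under two labellings, \<open>D\<close> is the fibre over the point where these differ,
  \<open>w\<close> its mass and \<open>c\<close> the affinity of the two label laws there. The first
  bound counts the samples that avoid \<open>D\<close>; the second sums
  \<open>min_ge_affinity\<close> over all samples.\<close>

lemma sum_min_prod_ge:
  fixes p q :: "'b \<Rightarrow> real"
  assumes S: "finite S" and p: "\<And>s. s \<in> S \<Longrightarrow> p s \<ge> 0" "sum p S = 1"
    and q: "\<And>s. s \<in> S \<Longrightarrow> q s \<ge> 0" "sum q S = 1"
    and D: "D \<subseteq> S" "\<And>s. s \<in> S - D \<Longrightarrow> p s = q s"
    and w: "sum p D = w" "sum q D = w"
    and aff: "\<And>s. s \<in> D \<Longrightarrow> sqrt (p s * q s) = c * ((p s + q s)/2)"
    and c: "c\<^sup>2 = 1 - \<xi>\<^sup>2" and \<xi>: "\<xi> \<ge> 0"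
  shows "(\<Sum>z\<in>(PiE {..<n} (\<lambda>_. S)). min (\<Prod>i<n. p (z i)) (\<Prod>i<n. q (z i)))
     \<ge> max ((1 - w)^n) (1 - \<xi> * sqrt (real n * w))" (is "?L \<ge> _")
proof -
  let ?X = "PiE {..<n} (\<lambda>_. S)"
  let ?P = "\<lambda>z. \<Prod>i<n. p (z i)" and ?Q = "\<lambda>z. \<Prod>i<n. q (z i)"
  have zS: "z i \<in> S" if "z \<in> ?X" "i < n" for z i using that by auto
  have P0: "?P z \<ge> 0" "?Q z \<ge> 0" if "z \<in> ?X" for z
    using zS[OF that] p q by (auto intro!: prod_nonneg)
  have finD: "finite D" using S D finite_subset by blast
  have split: "sum f S = sum f D + sum f (S - D)" for f :: "'b \<Rightarrow> real"
    using sum.subset_diff[OF D(1) S, of f] by simp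
  have rest: "sum p (S - D) = 1 - w" "sum q (S - D) = 1 - w"
    using split[of p] split[of q] p q w by auto
  have w0: "0 \<le> w" using w(1) p(1) D(1) by (metis subsetD sum_nonneg)
  have w1: "w \<le> 1" using rest(1) p(1) sum_nonneg[of "S - D" p] by auto
  have 1: "(1 - w)^n \<le> ?L"
  proof -
    \<comment> \<open>\<open>r\<close> is the part of \<open>p\<close> and \<open>q\<close> outside
      \<open>D\<close>, hence a minorant of both.\<close>
    define r where "r s = (if s \<in> D then 0 else p s)" for s
    have "sum r S = 1 - w" unfolding split[of r] using rest by (simp add: r_def)
    then have "(1 - w)^n = (\<Sum>z\<in>?X. \<Prod>i<n. r (z i))" by (simp add: sum_PiE_prod_power[OF S])
    also have "\<dots> \<le> ?L"
    proof (intro sum_mono min.boundedI)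
      fix z assume z: "z \<in> ?X"
      have *: "0 \<le> r (z i) \<and> r (z i) \<le> p (z i)" "0 \<le> r (z i) \<and> r (z i) \<le> q (z i)" if "i < n" for i
        using zS[OF z that] p(1) q(1) D(2) by (auto simp: r_def)
      show "(\<Prod>i<n. r (z i)) \<le> ?P z" "(\<Prod>i<n. r (z i)) \<le> ?Q z"
        using * by (auto intro!: prod_mono)
    qed
    finally show ?thesis .
  qed
  have 2: "1 - \<xi> * sqrt (real n * w) \<le> ?L"
  proof (cases "\<xi> * sqrt (real n * w) = 0")
    case False
    \<comment> \<open>This \<open>s\<close> minimises
      \<open>s/2 + n * w * \<xi>\<^sup>2 / (2 * s)\<close>, the loss that remains once
      \<open>h\<close> is bounded by Bernoulli's inequality.\<close>
    define s where "s = \<xi> * sqrt (real n * w)"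
    have "s \<ge> 0" unfolding s_def using \<xi> w0 by (intro mult_nonneg_nonneg) auto
    then have s: "s > 0" using False unfolding s_def by linarith
    \<comment> \<open>\<open>T z\<close> is \<open>c\<close> to the number of observations in
      \<open>D\<close>. With this choice the mean of its square under either sample law and its sum
      against \<open>sqrt (?P z * ?Q z)\<close> share one value \<open>h\<close>.\<close>
    define \<tau> where "\<tau> x = (if x \<in> D then c else 1)" for x
    define T where "T z = (\<Prod>i<n. \<tau> (z i))" for z
    define h where "h = (1 - w*\<xi>\<^sup>2)^n"
    have t2: "(\<Sum>x\<in>S. (\<tau> x)\<^sup>2 * f x) = c\<^sup>2 * sum f D + sum f (S - D)" for f
      unfolding split[of "\<lambda>x. (\<tau> x)\<^sup>2 * f x"] by (simp add: \<tau>_def sum_distrib_left)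
    have tp: "(\<Sum>x\<in>S. (\<tau> x)\<^sup>2 * p x) = 1 - w*\<xi>\<^sup>2" "(\<Sum>x\<in>S. (\<tau> x)\<^sup>2 * q x) = 1 - w*\<xi>\<^sup>2"
      by (simp_all only: t2 rest w c) (simp_all add: algebra_simps)
    have ta: "(\<Sum>x\<in>S. \<tau> x * sqrt (p x * q x)) = 1 - w*\<xi>\<^sup>2"
    proof -
      have "(\<Sum>x\<in>D. \<tau> x * sqrt (p x * q x)) = (\<Sum>x\<in>D. c\<^sup>2 * ((p x + q x)/2))"
        by (intro sum.cong refl) (simp add: \<tau>_def aff power2_eq_square)
      also have "\<dots> = c\<^sup>2 * ((sum p D + sum q D)/2)"
        by (simp only: sum.distrib flip: sum_distrib_left sum_divide_distrib)
      also have "\<dots> = (1 - \<xi>\<^sup>2) * w" by (simp add: c w)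
      finally have "(\<Sum>x\<in>D. \<tau> x * sqrt (p x * q x)) = (1 - \<xi>\<^sup>2) * w" .
      moreover have "(\<Sum>x\<in>S-D. \<tau> x * sqrt (p x * q x)) = (\<Sum>x\<in>S-D. p x)"
      proof (intro sum.cong refl)
        fix x assume x: "x \<in> S - D"
        then have "q x = p x" "p x \<ge> 0" using D(2)[OF x] p(1)[of x] by auto
        then show "\<tau> x * sqrt (p x * q x) = p x" using x by (simp add: \<tau>_def)
      qed
      ultimately show ?thesis
        unfolding split[of "\<lambda>x. \<tau> x * sqrt (p x * q x)"] using rest by (simp add: algebra_simps)
    qed
    have sP: "(\<Sum>z\<in>?X. ?P z) = 1" "(\<Sum>z\<in>?X. ?Q z) = 1"
      using p(2) q(2) by (simp_all add: sum_PiE_prod_power[OF S])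
    have sT: "(\<Sum>z\<in>?X. (T z)\<^sup>2 * ?P z) = h" "(\<Sum>z\<in>?X. (T z)\<^sup>2 * ?Q z) = h"
      using sum_PiE_prod_power[OF S, of "\<lambda>x. (\<tau> x)\<^sup>2 * p x" n]
        sum_PiE_prod_power[OF S, of "\<lambda>x. (\<tau> x)\<^sup>2 * q x" n]
      by (simp_all add: T_def h_def tp prod.distrib prod_power_distrib)
    have sqrt_prod: "sqrt (prod f I) = (\<Prod>i\<in>I. sqrt (f i))" for f :: "nat \<Rightarrow> real" and I
      by (induction I rule: infinite_finite_induct) (auto simp: real_sqrt_mult)
    have sA: "(\<Sum>z\<in>?X. T z * sqrt (?P z * ?Q z)) = h"
    proof -
      have "sqrt (?P z * ?Q z) = (\<Prod>i<n. sqrt (p (z i) * q (z i)))" for z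
        by (simp only: sqrt_prod flip: prod.distrib)
      then show ?thesis
        using sum_PiE_prod_power[OF S, of "\<lambda>x. \<tau> x * sqrt (p x * q x)" n]
        by (simp add: T_def h_def ta prod.distrib)
    qed
    have ber: "1 - h \<le> real n * (w*\<xi>\<^sup>2)"
    proof -
      have "\<xi>\<^sup>2 \<le> 1" using c zero_le_power2[of c] by linarith
      then have "w * \<xi>\<^sup>2 \<le> 1 * 1" using w0 w1 by (intro mult_mono) auto
      then show ?thesis using Bernoulli_inequality[of "- (w*\<xi>\<^sup>2)" n] by (simp add: h_def)
    qed
    have s2: "s\<^sup>2 = real n * (w*\<xi>\<^sup>2)"
      using w0 by (simp add: s_def power_mult_distrib)
    have "1 - s \<le> 1 - s/2 - (1 - h)/(2 * s)"
      using ber s2 s by (simp add: field_simps power2_eq_square)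
    also have "\<dots> = (1 - s/2 - 1/(2 * s)) * ((1 + 1)/2) - ((h + h)/2) / (2 * s) + h / s"
      using s by (simp add: field_simps)
    also have "\<dots> = (\<Sum>z\<in>?X. (1 - s/2 - 1/(2 * s)) * ((?P z + ?Q z)/2)
        - ((T z)\<^sup>2 * ?P z + (T z)\<^sup>2 * ?Q z)/2 / (2 * s) + T z * sqrt (?P z * ?Q z) / s)"
      by (simp only: sum.distrib sum_subtractf sP sT sA flip: sum_distrib_left sum_divide_distrib)
    also have "\<dots> \<le> ?L"
    proof (rule sum_mono)
      fix z assume "z \<in> ?X"
      from min_ge_affinity[OF P0[OF this] s, of "T z"]
      show "(1 - s/2 - 1/(2 * s)) * ((?P z + ?Q z)/2)
        - ((T z)\<^sup>2 * ?P z + (T z)\<^sup>2 * ?Q z)/2 / (2 * s) + T z * sqrt (?P z * ?Q z) / s \<le> min (?P z) (?Q z)"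
        by (simp add: algebra_simps)
    qed
    finally show ?thesis by (simp add: s_def)
  next
    case True
    \<comment> \<open>These are the cases in which \<open>s\<close> would vanish. If
      \<open>\<xi> = 0\<close>, the affinity forces \<open>p = q\<close> on \<open>D\<close>; if
      \<open>n = 0\<close> or \<open>w = 0\<close>, the first bound is already 1.\<close>
    then consider "\<xi> = 0" | "n = 0" | "w = 0" by auto
    then have "?L \<ge> 1"
    proof cases
      case 1
      have "p s = q s" if "s \<in> D" for s
      proof -
        have s: "p s \<ge> 0" "q s \<ge> 0" using p q D(1) that by auto
        have "sqrt (p s * q s) ^ 2 = c\<^sup>2 * ((p s + q s)/2)^2"
          by (simp only: aff[OF that] power_mult_distrib)
        then have "sqrt (p s * q s) ^ 2 = ((p s + q s)/2)^2" using c 1 by simp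
        then have "(p s - q s)\<^sup>2 = 0" using s by (simp add: power2_eq_square field_simps)
        then show ?thesis by simp
      qed
      then have "p s = q s" if "s \<in> S" for s using D(2) that by blast
      then have "?P z = ?Q z" if "z \<in> ?X" for z
        using zS[OF that] by (intro prod.cong) auto
      then have "?L = (\<Sum>z\<in>?X. ?P z)" by (intro sum.cong) auto
      then show ?thesis using p(2) by (simp add: sum_PiE_prod_power[OF S])
    qed (use \<open>(1 - w)^n \<le> ?L\<close> in auto)
    then show ?thesis unfolding True by simp
  qed
  show ?thesis using 1 2 by simp
qed

section \<open>Noisy labellings of a shattered set\<close>

locale labelled_points =
  fixes M :: "'a measure" and G :: "('a \<Rightarrow> bool) set" and A :: "'a set" and u \<eta> :: "'a \<Rightarrow> real"
  assumes finite_A: "finite A" and A_space: "A \<subseteq> space M"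
    and u_nonneg: "\<And>x. x \<in> A \<Longrightarrow> 0 \<le> u x" and sum_u: "sum u A = 1"
    and noise: "\<And>x. x \<in> A \<Longrightarrow> 0 \<le> \<eta> x" "\<And>x. x \<in> A \<Longrightarrow> \<eta> x \<le> 1/2"
    and G: "G \<subseteq> prediction_functions M" "shatters G A"
begin

text \<open>As \<open>\<eta> \<le> 1/2\<close> on \<open>A\<close>, membership in \<open>B\<close>
  is a Bayes classifier there.\<close>

definition dens :: "'a set \<Rightarrow> 'a \<times> bool \<Rightarrow> real" where
  "dens B = (\<lambda>(x, y). if x \<in> A then u x * (if y = (x \<in> B) then 1 - \<eta> x else \<eta> x) else 0)"

definition model :: "'a set \<Rightarrow> ('a \<times> bool) measure" where
  "model B = pmf_on (labelled_space M) (embed_pmf (dens B))"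

lemma dens_nonneg: "0 \<le> dens B s"
  using u_nonneg noise by (cases s) (fastforce simp: dens_def intro!: mult_nonneg_nonneg)

lemma sum_dens_fibre: "x \<in> A \<Longrightarrow> dens B (x, True) + dens B (x, False) = u x"
  by (auto simp: dens_def algebra_simps)

lemma sum_points: "(\<Sum>s\<in>A \<times> UNIV. f s) = (\<Sum>x\<in>A. f (x, True) + f (x, False))"
  for f :: "'a \<times> bool \<Rightarrow> real"
  by (simp add: UNIV_bool add.commute sum.cartesian_product')

lemma sum_dens: "sum (dens B) (A \<times> UNIV) = 1"
  using sum_u by (simp add: sum_points sum_dens_fibre)

lemma pmf_dens: "pmf (embed_pmf (dens B)) s = dens B s"
proof (rule pmf_embed_pmf)
  have "(\<integral>\<^sup>+s. ennreal (dens B s) \<partial>count_space UNIV) = (\<Sum>s\<in>A \<times> UNIV. ennreal (dens B s))"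
    using finite_A by (intro nn_integral_count_space') (auto simp: dens_def split: if_splits)
  also have "\<dots> = ennreal (sum (dens B) (A \<times> UNIV))"
    by (intro sum_ennreal dens_nonneg)
  finally show "(\<integral>\<^sup>+s. ennreal (dens B s) \<partial>count_space UNIV) = 1" by (simp add: sum_dens)
qed (rule dens_nonneg)

lemma set_pmf_dens: "set_pmf (embed_pmf (dens B)) \<subseteq> A \<times> UNIV"
  by (auto simp: set_pmf_eq pmf_dens) (auto simp: dens_def split: if_splits)

lemma points_in_space: "A \<times> UNIV \<subseteq> space (labelled_space M)"
  using A_space by (auto simp: labelled_space_def space_pair_measure)

lemma model_distribution: "model B \<in> distributions M"
  using set_pmf_dens points_in_space
  by (auto simp: distributions_def model_def intro!: prob_space_pmf_on)

text \<open>At \<open>x\<close>, agreeing with \<open>B\<close> costs \<open>u x * \<eta> x\<close>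
  and disagreeing costs \<open>u x * (1 - \<eta> x)\<close>; the difference carries the factor
  \<open>1 - 2 * \<eta> x\<close>.\<close>

lemma risk_model:
  assumes "g \<in> prediction_functions M"
  shows "risk (model B) g
    = (\<Sum>x\<in>A. u x * \<eta> x) + (\<Sum>x\<in>A. u x * (1 - 2 * \<eta> x) * of_bool (g x \<noteq> (x \<in> B)))"
proof -
  define E where "E = {(x, y) \<in> space (labelled_space M). y \<noteq> g x}"
  have [measurable]: "g \<in> measurable M (count_space UNIV)"
    using assms by (simp add: prediction_functions_def)
  have "{s \<in> space (M \<Otimes>\<^sub>M count_space UNIV). snd s \<noteq> g (fst s)} \<in> sets (M \<Otimes>\<^sub>M count_space UNIV)"
    by measurable
  then have E: "E \<in> sets (labelled_space M)"
    by (simp add: E_def labelled_space_def case_prod_unfold)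
  have sub: "set_pmf (embed_pmf (dens B)) \<subseteq> space (labelled_space M)"
    using set_pmf_dens points_in_space by blast
  have "risk (model B) g = measure_pmf.prob (embed_pmf (dens B)) E"
  proof -
    have "{(x, y) \<in> space (model B). y \<noteq> g x} = E"
      by (simp add: E_def model_def)
    then show ?thesis
      unfolding risk_def by (simp only: model_def measure_pmf_on[OF sub E])
  qed
  also have "\<dots> = measure_pmf.prob (embed_pmf (dens B)) (E \<inter> (A \<times> UNIV))"
    using set_pmf_dens by (intro measure_prob_cong_0) (auto simp: set_pmf_eq)
  also have "\<dots> = (\<Sum>s\<in>E \<inter> (A \<times> UNIV). dens B s)"
    using finite_A by (subst measure_measure_pmf_finite) (auto simp: pmf_dens)
  also have "\<dots> = (\<Sum>s\<in>A \<times> UNIV. if s \<in> E then dens B s else 0)"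
    using finite_A by (subst Int_commute, subst sum.inter_restrict) auto
  also have "\<dots> = (\<Sum>x\<in>A. u x * \<eta> x + u x * (1 - 2 * \<eta> x) * of_bool (g x \<noteq> (x \<in> B)))"
    unfolding sum_points using points_in_space
    by (intro sum.cong refl) (auto simp: E_def dens_def algebra_simps)
  finally show ?thesis by (simp add: sum.distrib)
qed

text \<open>The second sum in \<open>risk_model\<close> is nonnegative and vanishes for a
  \<open>g\<close> in \<open>G\<close> that cuts \<open>B\<close> out of \<open>A\<close>, so the
  infimum is attained.\<close>

lemma inf_risk_model:
  assumes "B \<subseteq> A"
  shows "(INF g\<in>G. risk (model B) g) = (\<Sum>x\<in>A. u x * \<eta> x)"
proof -
  obtain g where g: "g \<in> G" "{x \<in> A. g x} = B"
    using G(2) assms unfolding shatters_def by blast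
  have ge: "risk (model B) f \<ge> (\<Sum>x\<in>A. u x * \<eta> x)" if "f \<in> G" for f
  proof -
    have "(\<Sum>x\<in>A. u x * (1 - 2 * \<eta> x) * of_bool (f x \<noteq> (x \<in> B))) \<ge> 0"
      using u_nonneg noise by (intro sum_nonneg mult_nonneg_nonneg) force+
    then show ?thesis using risk_model that G(1) by auto
  qed
  have "risk (model B) g = (\<Sum>x\<in>A. u x * \<eta> x)"
  proof -
    have "(\<Sum>x\<in>A. u x * (1 - 2 * \<eta> x) * of_bool (g x \<noteq> (x \<in> B))) = 0"
      using g(2) by (intro sum.neutral) auto
    then show ?thesis using risk_model g G(1) by auto
  qed
  then show ?thesis
    using g ge by (intro cInf_eq_minimum) (auto intro: rev_image_eqI)
qed

text \<open>The probability that \<open>ghat\<close>, trained on \<open>n\<close> observations from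
  \<open>model B\<close>, mislabels \<open>x\<close>.\<close>

definition err :: "nat \<Rightarrow> ((nat \<Rightarrow> 'a \<times> bool) \<Rightarrow> 'a \<Rightarrow> bool) \<Rightarrow> 'a set \<Rightarrow> 'a \<Rightarrow> real" where
  "err n ghat B x = (\<Sum>z\<in>(PiE {..<n} (\<lambda>_. A \<times> UNIV)).
     (\<Prod>i<n. dens B (z i)) * of_bool (ghat z x \<noteq> (x \<in> B)))"

lemma excess_risk_model:
  assumes "estimator M n ghat" "B \<subseteq> A"
  shows "excess_risk G (model B) n ghat = (\<Sum>x\<in>A. u x * (1 - 2 * \<eta> x) * err n ghat B x)"
proof -
  let ?X = "PiE {..<n} (\<lambda>_. A \<times> (UNIV :: bool set))"
  let ?W = "\<lambda>z. \<Prod>i<n. dens B (z i)"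
  have X: "?X \<subseteq> space (PiM {..<n} (\<lambda>_. labelled_space M))"
    using points_in_space by (auto simp: space_PiM PiE_iff)
  have "expected_risk (model B) n ghat = (\<Sum>z\<in>?X. ?W z * risk (model B) (ghat z))"
    unfolding expected_risk_def
    unfolding model_def[of B]
    using assms model_distribution[of B] finite_A set_pmf_dens points_in_space
    by (subst integral_PiM_pmf_on) (auto simp: pmf_dens estimator_def model_def)
  also have "\<dots> = (\<Sum>z\<in>?X. ?W z * (\<Sum>x\<in>A. u x * \<eta> x)
      + (\<Sum>x\<in>A. u x * (1 - 2 * \<eta> x) * (?W z * of_bool (ghat z x \<noteq> (x \<in> B)))))"
  proof (rule sum.cong[OF refl])
    fix z assume "z \<in> ?X"
    then have "ghat z \<in> prediction_functions M"
      using X assms(1) unfolding estimator_def by blast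
    from risk_model[OF this, of B]
    show "?W z * risk (model B) (ghat z) = ?W z * (\<Sum>x\<in>A. u x * \<eta> x)
      + (\<Sum>x\<in>A. u x * (1 - 2 * \<eta> x) * (?W z * of_bool (ghat z x \<noteq> (x \<in> B))))"
      by (simp add: distrib_left sum_distrib_left mult.left_commute)
  qed
  also have "\<dots> = (\<Sum>z\<in>?X. ?W z) * (\<Sum>x\<in>A. u x * \<eta> x) + (\<Sum>x\<in>A. u x * (1 - 2 * \<eta> x) * err n ghat B x)"
  proof -
    have "(\<Sum>z\<in>?X. \<Sum>x\<in>A. u x * (1 - 2 * \<eta> x) * (?W z * of_bool (ghat z x \<noteq> (x \<in> B))))
        = (\<Sum>x\<in>A. u x * (1 - 2 * \<eta> x) * err n ghat B x)"
      unfolding err_def sum_distrib_left by (rule sum.swap)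
    then show ?thesis by (simp only: sum.distrib sum_distrib_right)
  qed
  also have "(\<Sum>z\<in>?X. ?W z) = 1"
    using sum_dens finite_A by (simp add: sum_PiE_prod_power)
  finally show ?thesis by (simp add: excess_risk_def inf_risk_model[OF assms(2)])
qed

abbreviation flip :: "'a \<Rightarrow> 'a set \<Rightarrow> 'a set" where
  "flip x B \<equiv> (if x \<in> B then B - {x} else insert x B)"

text \<open>On each sample the prediction at \<open>x\<close> is wrong for exactly one of the two
  labellings, so the two errors together cost at least the smaller of the two sample
  weights.\<close>

lemma err_pair_ge:
  assumes "x \<in> A"
  shows "err n ghat B x + err n ghat (flip x B) x
     \<ge> max ((1 - u x)^n) (1 - (1 - 2 * \<eta> x) * sqrt (real n * u x))"
proof -
  let ?X = "PiE {..<n} (\<lambda>_. A \<times> (UNIV :: bool set))"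
  let ?P = "\<lambda>B z. \<Prod>i<n. dens B (z i)"
  note \<eta> = noise[OF assms]
  have fibre: "sum (dens B) ({x} \<times> UNIV) = u x" for B
    using sum_dens_fibre[OF assms] by (simp add: UNIV_bool add.commute sum.cartesian_product')
  have "max ((1 - u x)^n) (1 - (1 - 2 * \<eta> x) * sqrt (real n * u x))
      \<le> (\<Sum>z\<in>?X. min (?P B z) (?P (flip x B) z))"
  \<comment> \<open>This \<open>c\<close> is the affinity of the Bernoulli laws with parameters
    \<open>\<eta> x\<close> and \<open>1 - \<eta> x\<close>, which makes \<open>\<xi>\<close> equal
    to \<open>1 - 2 * \<eta> x\<close>.\<close>
  proof (rule sum_min_prod_ge[where D = "{x} \<times> UNIV" and c = "2 * sqrt (\<eta> x * (1 - \<eta> x))"])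
    have "0 \<le> \<eta> x * (1 - \<eta> x)" using \<eta> by simp
    then have "(2 * sqrt (\<eta> x * (1 - \<eta> x)))\<^sup>2 = 4 * (\<eta> x * (1 - \<eta> x))"
      by (simp add: power_mult_distrib)
    then show "(2 * sqrt (\<eta> x * (1 - \<eta> x)))\<^sup>2 = 1 - (1 - 2 * \<eta> x)\<^sup>2"
      by (simp add: power2_eq_square algebra_simps)
    show "dens B s = dens (flip x B) s" if "s \<in> A \<times> UNIV - {x} \<times> UNIV" for s
      using that by (cases s) (simp add: dens_def)
    fix s :: "'a \<times> bool" assume "s \<in> {x} \<times> UNIV"
    then have "dens B s * dens (flip x B) s = (u x)\<^sup>2 * (\<eta> x * (1 - \<eta> x))"
      "dens B s + dens (flip x B) s = u x"
      using assms by (auto simp: dens_def power2_eq_square algebra_simps)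
    then show "sqrt (dens B s * dens (flip x B) s)
        = 2 * sqrt (\<eta> x * (1 - \<eta> x)) * ((dens B s + dens (flip x B) s) / 2)"
      using u_nonneg[OF assms] by (simp add: real_sqrt_mult)
  qed (use assms finite_A \<eta> in \<open>auto simp: dens_nonneg sum_dens fibre simp del: if_split\<close>)
  also have "\<dots> \<le> (\<Sum>z\<in>?X. ?P B z * of_bool (ghat z x \<noteq> (x \<in> B))
      + ?P (flip x B) z * of_bool (ghat z x \<noteq> (x \<in> flip x B)))"
    by (intro sum_mono) auto
  also have "\<dots> = err n ghat B x + err n ghat (flip x B) x"
    by (simp only: err_def sum.distrib)
  finally show ?thesis .
qed

lemma exists_model_excess_risk_ge:
  assumes "estimator M n ghat"
  shows "\<exists>P \<in> distributions M. (INF g\<in>G. risk P g) = (\<Sum>x\<in>A. u x * \<eta> x) \<and>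
    excess_risk G P n ghat \<ge> (\<Sum>x\<in>A. u x * (1 - 2 * \<eta> x) *
      max ((1 - u x)^n) (1 - (1 - 2 * \<eta> x) * sqrt (real n * u x))) / 2"
proof -
  define k where "k x = max ((1 - u x)^n) (1 - (1 - 2 * \<eta> x) * sqrt (real n * u x))" for x
  define b where "b = (\<Sum>x\<in>A. u x * (1 - 2 * \<eta> x) * k x) / 2"
  let ?F = "\<lambda>B. excess_risk G (model B) n ghat"
  have pair: "card (Pow A) * k x \<le> 2 * (\<Sum>B\<in>Pow A. err n ghat B x)" if x: "x \<in> A" for x
  proof -
    \<comment> \<open>\<open>flip x\<close> is an involution of \<open>Pow A\<close>.\<close>
    have "(\<Sum>B\<in>Pow A. err n ghat (flip x B) x) = (\<Sum>B\<in>Pow A. err n ghat B x)"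
      using x by (intro sum.reindex_bij_witness[where i = "flip x" and j = "flip x"]) auto
    moreover have "(\<Sum>B\<in>Pow A. k x) \<le> (\<Sum>B\<in>Pow A. err n ghat B x + err n ghat (flip x B) x)"
      unfolding k_def by (intro sum_mono err_pair_ge x)
    ultimately show ?thesis by (simp add: sum.distrib)
  qed
  have "(\<Sum>B\<in>Pow A. b) = (\<Sum>x\<in>A. u x * (1 - 2 * \<eta> x) * (card (Pow A) * k x / 2))"
    by (simp add: b_def sum_distrib_left sum_divide_distrib mult_ac)
  also have "\<dots> \<le> (\<Sum>x\<in>A. u x * (1 - 2 * \<eta> x) * (\<Sum>B\<in>Pow A. err n ghat B x))"
    using pair u_nonneg noise by (intro sum_mono mult_left_mono mult_nonneg_nonneg) force+
  also have "\<dots> = (\<Sum>B\<in>Pow A. \<Sum>x\<in>A. u x * (1 - 2 * \<eta> x) * err n ghat B x)"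
    by (subst sum.swap) (simp add: sum_distrib_left)
  also have "\<dots> = (\<Sum>B\<in>Pow A. ?F B)"
    using excess_risk_model[OF assms] by (intro sum.cong) auto
  \<comment> \<open>The average over all labellings is at least \<open>b\<close>, so some labelling,
    depending on \<open>ghat\<close>, reaches \<open>b\<close>.\<close>
  finally have "\<not> (\<forall>B\<in>Pow A. ?F B < b)"
    using sum_strict_mono[of "Pow A" ?F "\<lambda>_. b"] finite_A by fastforce
  then obtain B where "B \<subseteq> A" "?F B \<ge> b" by (auto simp: not_less)
  then show ?thesis
    using inf_risk_model model_distribution unfolding b_def k_def by blast
qed

end

section \<open>From the VC-dimension to uniform and heavy-point lower bounds\<close>

text \<open>A set of extended naturals with finite supremum is finite, so a nonempty one attains it;
  \<open>V > 0\<close> excludes the empty set, whose supremum is 0.\<close>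

lemma vc_dim_attained:
  assumes "vc_dim X G = enat V" "V > 0"
  obtains A where "A \<subseteq> X" "finite A" "shatters G A" "card A = V"
proof -
  define C where "C = {enat (card A) | A. A \<subseteq> X \<and> finite A \<and> shatters G A}"
  have "Sup C = enat V" using assms(1) by (simp add: vc_dim_def C_def)
  then have "C \<noteq> {}" "finite C" "Max C = enat V"
    using assms(2) by (auto simp: Sup_enat_def zero_enat_def split: if_splits)
  then have "enat V \<in> C" using Max_in[of C] by simp
  then show thesis using that unfolding C_def by auto
qed

text \<open>Inverting \<open>(1 + 1/n)^n \<le> exp 1\<close> gives this bound for missing a point of
  weight \<open>1/(n + 1)\<close>.\<close>

lemma exp_minus_one_le_power: "exp (-1) \<le> (1 - 1 / (real n + 1)) ^ n"
proof (cases "n = 0")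
  case False
  have "(1 + 1 / real n) ^ n \<le> exp (1 / real n) ^ n"
    by (intro power_mono exp_ge_add_one_self) auto
  also have "\<dots> = exp 1" using False by (simp flip: exp_of_nat_mult)
  finally have "inverse (exp 1) \<le> inverse ((1 + 1 / real n) ^ n)"
    by (rule le_imp_inverse_le) (simp add: add_pos_nonneg)
  also have "\<dots> = inverse (1 + 1 / real n) ^ n" by (rule power_inverse[symmetric])
  also have "inverse (1 + 1 / real n) = 1 - 1 / (real n + 1)"
    using False by (simp add: field_simps)
  finally show ?thesis by (simp add: exp_minus)
qed simp

text \<open>Equal noise at all points ties the infimum to \<open>\<xi>\<close>: prescribing the
  value \<open>L\<close> forces \<open>\<xi> = 1 - 2 * L\<close>.\<close>

lemma uniform_lower_bound:
  fixes \<xi> :: real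
  assumes "finite A" "A \<subseteq> space M" "A \<noteq> {}" "0 \<le> \<xi>" "\<xi> \<le> 1"
    and "G \<subseteq> prediction_functions M" "shatters G A" "estimator M n ghat"
  shows "\<exists>P \<in> distributions M. (INF g\<in>G. risk P g) = (1 - \<xi>) / 2 \<and>
    excess_risk G P n ghat
      \<ge> \<xi> / 2 * max ((1 - 1 / real (card A))^n) (1 - \<xi> * sqrt (real n / real (card A)))"
proof -
  have card: "card A > 0" using assms by (simp add: card_gt_0_iff)
  interpret labelled_points M G A "\<lambda>_. 1 / real (card A)" "\<lambda>_. (1 - \<xi>) / 2"
    using assms card by unfold_locales auto
  let ?c = "real (card A)"
  have signal: "1 - 2 * ((1 - \<xi>) / 2) = \<xi>" by (simp add: field_simps)
  have noise_sum: "(\<Sum>x\<in>A. 1 / ?c * ((1 - \<xi>) / 2)) = (1 - \<xi>) / 2" using card by simp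
  have signal_sum: "(\<Sum>x\<in>A. 1 / ?c * (1 - 2 * ((1 - \<xi>) / 2)) *
      max ((1 - 1 / ?c)^n) (1 - (1 - 2 * ((1 - \<xi>) / 2)) * sqrt (real n * (1 / ?c)))) / 2
    = \<xi> / 2 * max ((1 - 1 / ?c)^n) (1 - \<xi> * sqrt (real n / ?c))"
  proof -
    have "?c * (1 / ?c * \<xi> * X) / 2 = \<xi> / 2 * X" for X using card by simp
    then show ?thesis unfolding signal sum_constant times_divide_eq_right[of "real n"] mult_1_right .
  qed
  show ?thesis using exists_model_excess_risk_ge[OF assms(8)] unfolding noise_sum signal_sum .
qed

text \<open>One point absorbs the mass \<open>1 - m * w\<close> left by \<open>m\<close> light
  points. Its own excess is only used as nonnegative, so its noise \<open>\<zeta>\<close> can raise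
  the infimum without weakening the bound.\<close>

lemma heavy_point_lower_bound:
  fixes w \<xi> \<zeta> :: real
  assumes "finite A" "A \<subseteq> space M" "A \<noteq> {}" and m: "m = real (card A) - 1"
    and w: "0 \<le> w" "m * w \<le> 1" and \<xi>: "0 \<le> \<xi>" "\<xi> \<le> 1" and \<zeta>: "0 \<le> \<zeta>" "\<zeta> \<le> 1/2"
    and "G \<subseteq> prediction_functions M" "shatters G A" and ghat: "estimator M n ghat"
  shows "\<exists>P \<in> distributions M. (INF g\<in>G. risk P g) = m * (w * (1 - \<xi>) / 2) + (1 - m * w) * \<zeta> \<and>
    excess_risk G P n ghat \<ge> m * w * \<xi> / 2 * max ((1 - w)^n) (1 - \<xi> * sqrt (real n * w))"
proof -
  obtain a where a: "a \<in> A" using assms by blast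
  define u where "u x = (if x = a then 1 - m * w else w)" for x
  define \<eta> where "\<eta> x = (if x = a then \<zeta> else (1 - \<xi>) / 2)" for x
  have card: "real (card (A - {a})) = m"
  proof -
    have "card A \<ge> 1" using a assms(1) by (auto simp: Suc_le_eq card_gt_0_iff)
    then show ?thesis using a m by (simp add: card_Diff_singleton of_nat_diff)
  qed
  then have m0: "m \<ge> 0" by (metis of_nat_0_le_iff)
  have split: "(\<Sum>x\<in>A. f x) = f a + m * c" if "\<And>x. x \<noteq> a \<Longrightarrow> f x = c" for f and c :: real
    using a assms(1) card that by (simp add: sum.remove[of A a])
  interpret labelled_points M G A u \<eta>
  proof
    show "sum u A = 1" using split[of u w] by (simp add: u_def)
  qed (use assms in \<open>auto simp: u_def \<eta>_def\<close>)
  have signal: "1 - 2 * \<eta> x = (if x = a then 1 - 2 * \<zeta> else \<xi>)" for x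
    by (simp add: \<eta>_def field_simps)
  let ?f = "\<lambda>x. u x * (1 - 2 * \<eta> x) * max ((1 - u x)^n) (1 - (1 - 2 * \<eta> x) * sqrt (real n * u x))"
  have "?f a \<ge> 0"
    using m0 w \<zeta> by (intro mult_nonneg_nonneg max.coboundedI1 zero_le_power) (auto simp: u_def signal)
  moreover have "sum ?f A = ?f a + m * (w * \<xi> * max ((1 - w)^n) (1 - \<xi> * sqrt (real n * w)))"
    unfolding signal by (rule split) (simp add: u_def)
  ultimately have signal_sum: "m * w * \<xi> / 2 * max ((1 - w)^n) (1 - \<xi> * sqrt (real n * w)) \<le> sum ?f A / 2"
    by simp
  have noise_sum: "(\<Sum>x\<in>A. u x * \<eta> x) = m * (w * (1 - \<xi>) / 2) + (1 - m * w) * \<zeta>"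
    by (subst split[of _ "w * (1 - \<xi>) / 2"]) (auto simp: u_def \<eta>_def)
  obtain P where P: "P \<in> distributions M" "(INF g\<in>G. risk P g) = (\<Sum>x\<in>A. u x * \<eta> x)"
    "sum ?f A / 2 \<le> excess_risk G P n ghat"
    using exists_model_excess_risk_ge[OF ghat] by blast
  show ?thesis
    by (intro bexI[OF _ P(1)] conjI order.trans[OF signal_sum P(3)]) (simp only: P(2) noise_sum)
qed

section \<open>Choice of weight and noise\<close>

text \<open>
  The weight solves \<open>m (w - \<surd>w / (2 \<surd>N)) = 2 L\<close>, so that the noise level is \<open>L\<close> for the choice of
  \<open>\<xi>\<close> with \<open>\<xi> \<surd>(N w) = 1/2\<close>; \<open>r\<close> is the square root of \<open>w\<close>.
\<close>

lemma noise_level_solution: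
  fixes L m N :: real
  assumes L: "0 < L" "L \<le> 1/2" and m: "m > 0" and N: "N > 0" and cond: "m \<le> 4 * (1 - 2 * L)\<^sup>2 * N"
  obtains w \<xi> where "0 \<le> w" "m * w \<le> 1" "0 \<le> \<xi>" "\<xi> \<le> 1" "m * (w * (1 - \<xi>) / 2) = L"
    "sqrt (L * m / (32 * N)) \<le> m * w * \<xi> / 2 * (1 - \<xi> * sqrt (N * w))"
proof -
  define k where "k = 1 / (2 * sqrt N)"
  define q where "q = sqrt (k\<^sup>2 + 4 * (2 * L / m))"
  define r where "r = (k + q) / 2"
  have k: "k > 0" using N by (simp add: k_def)
  have kN: "k * sqrt N = 1/2" using N by (simp add: k_def)
  have k2: "k\<^sup>2 = 1 / (4 * N)" using N by (simp add: k_def power_divide power_mult_distrib)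
  have c: "2 * L / m > 0" using L m by simp
  have "sqrt (k\<^sup>2 + 4 * (2 * L / m)) \<ge> sqrt (k\<^sup>2)"
    using c by (intro real_sqrt_le_mono) auto
  then have rk: "r \<ge> k" using k by (simp add: r_def q_def)
  then have r: "r > 0" using k by linarith
  have "2 * r - k = q" unfolding r_def by (simp add: field_simps)
  moreover have "k\<^sup>2 + 4 * (2 * L / m) \<ge> 0" using c by (intro add_nonneg_nonneg) auto
  ultimately have "(2 * r - k)\<^sup>2 = k\<^sup>2 + 4 * (2 * L / m)" by (simp only: q_def real_sqrt_pow2)
  moreover have "(2 * r - k)\<^sup>2 = 4 * (r\<^sup>2 - k * r) + k\<^sup>2"
    by (simp add: power2_eq_square algebra_simps)
  ultimately have "4 * (r\<^sup>2 - k * r) = 4 * (2 * L / m)" by simp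
  then have root: "r\<^sup>2 - k * r = 2 * L / m" by (simp only: mult_cancel_left) simp
  then have mroot: "m * (r\<^sup>2 - k * r) = 2 * L" using m by simp
  have "(k * sqrt m)\<^sup>2 \<le> (1 - 2 * L)\<^sup>2"
    using cond N m by (simp add: power_mult_distrib k2 field_simps)
  then have ky: "k * sqrt m \<le> 1 - 2 * L"
    by (rule power2_le_imp_le) (use L in simp)
  \<comment> \<open>\<open>x = sqrt m * r\<close> solves
    \<open>x\<^sup>2 - k * sqrt m * x = 2 * L\<close>. By \<open>ky\<close> the left side is at
    least \<open>2 * L\<close> at \<open>x = 1\<close>, and it is strictly larger beyond.\<close>
  have mr: "m * r\<^sup>2 \<le> 1"
  proof (rule ccontr)
    assume "\<not> m * r\<^sup>2 \<le> 1"
    then have "1 < (sqrt m * r)\<^sup>2" using m by (simp add: power_mult_distrib)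
    then have big: "sqrt m * r > 1" by (rule power2_less_imp_less[of 1, simplified]) (use m r in simp_all)
    have "k * sqrt m \<le> sqrt m * r" using rk m by (simp add: mult.commute)
    then have "0 < (sqrt m * r - 1) * (sqrt m * r + 1 - k * sqrt m)"
      using big by (intro mult_pos_pos) linarith+
    also have "\<dots> = sqrt m * sqrt m * (r\<^sup>2 - k * r) - 1 + k * sqrt m"
      by (simp add: power2_eq_square algebra_simps)
    also have "\<dots> = 2 * L - 1 + k * sqrt m" using m mroot by simp
    finally show False using ky by simp
  qed
  show thesis
  proof (rule that[of "r\<^sup>2" "k / r"])
    show "0 \<le> r\<^sup>2" "m * r\<^sup>2 \<le> 1" "0 \<le> k / r" "k / r \<le> 1" using mr k r rk by auto
    show "m * (r\<^sup>2 * (1 - k / r) / 2) = L"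
      using mroot r by (simp add: power2_eq_square algebra_simps)
    have "k / r * sqrt (N * r\<^sup>2) = 1/2" using kN r by (simp add: real_sqrt_mult)
    then have eq: "m * r\<^sup>2 * (k / r) / 2 * (1 - k / r * sqrt (N * r\<^sup>2)) = m * r * k / 4"
      using r by (simp add: power2_eq_square)
    have "k * r > 0" using k r by simp
    \<comment> \<open>The value reached is \<open>m * r * k / 4\<close>; bounding
      \<open>m * r\<^sup>2\<close> below by \<open>2 * L\<close> makes it explicit in
      \<open>L\<close>.\<close>
    then have "2 * L \<le> m * r\<^sup>2"
      using mroot mult_pos_pos[OF m \<open>k * r > 0\<close>] by (simp add: right_diff_distrib)
    then have "L * m / (32 * N) \<le> (m * r\<^sup>2) * m / (64 * N)"
      using N m by (simp add: field_simps)
    also have "\<dots> = (m * r * k / 4)\<^sup>2"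
      by (simp add: power_mult_distrib power_divide k2) (simp add: power2_eq_square)
    finally have "sqrt (L * m / (32 * N)) \<le> m * r * k / 4"
      using m r k by (intro real_le_lsqrt) auto
    then show "sqrt (L * m / (32 * N)) \<le> m * r\<^sup>2 * (k / r) / 2 * (1 - k / r * sqrt (N * r\<^sup>2))"
      by (simp only: eq)
  qed
qed

text \<open>Squaring reduces the claim to \<open>t^3 \<le> 16 * (t - 1)^2\<close>, for which 13 is
  the largest possible integer. It serves the ratios \<open>t = V/n\<close> at which labels are
  taken noise-free.\<close>

lemma sqrt_le_of_intermediate_ratio:
  fixes t :: real
  assumes "4 \<le> t" "t \<le> 13"
  shows "1/8 * sqrt t \<le> 1/2 * (1 - 1/t)"
proof -
  have "(t * sqrt t)\<^sup>2 \<le> (4 * (t - 1))\<^sup>2"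
  proof -
    have "0 \<le> (t - 4) * (13 - t)" using assms by simp
    then have "0 \<le> t * ((t - 4) * (13 - t))" using assms by (intro mult_nonneg_nonneg) auto
    moreover have "(t * sqrt t)\<^sup>2 = t\<^sup>2 * t"
      using assms by (simp add: power_mult_distrib)
    moreover have "(4 * (t - 1))\<^sup>2 - t\<^sup>2 * t = t * ((t - 4) * (13 - t)) + (20 * t - t\<^sup>2 + 16)"
      by (simp add: power2_eq_square algebra_simps)
    moreover have "t\<^sup>2 \<le> 13 * t"
      unfolding power2_eq_square using assms by (intro mult_right_mono) auto
    ultimately show ?thesis using assms by linarith
  qed
  then have "t * sqrt t \<le> 4 * (t - 1)" by (rule power2_le_imp_le) (use assms in simp)
  then have "sqrt t \<le> 4 * (t - 1) / t"
    using assms by (subst pos_le_divide_eq) (auto simp: mult.commute)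
  also have "\<dots> = 4 * (1 - 1 / t)" using assms by (simp add: diff_divide_distrib)
  finally have "sqrt t \<le> 4 * (1 - 1 / t)" .
  then show ?thesis by linarith
qed

section \<open>The three lower bounds\<close>

theorem theorem8p8:
  fixes M :: "'a measure" and G :: "('a \<Rightarrow> bool) set" and V n :: nat and L :: real
    and ghat :: "(nat \<Rightarrow> 'a \<times> bool) \<Rightarrow> 'a \<Rightarrow> bool"
  assumes "0 \<le> L" and "L \<le> 1/2"
    and "G \<subseteq> prediction_functions M"
    and "vc_dim (space M) G = enat V" and "V \<ge> 2"
    and "estimator M n ghat"
  shows "(L = 0 \<longrightarrow> (\<exists>P \<in> distributions_with_inf_risk M G 0.
            excess_risk G P n ghat \<ge>
              (if real n \<ge> real V - 2
               then (real V - 1) / (2 * exp 1 * (real n + 1))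
               else 1/2 * (1 - 1 / real V) ^ n)))
       \<and> (0 < L \<and> L \<le> 1/2 \<longrightarrow> (\<exists>P \<in> distributions_with_inf_risk M G L.
            excess_risk G P n ghat \<ge>
              (if (1 - 2 * L)\<^sup>2 * real n / real V \<ge> 4/9
               then max (sqrt (L * (real V - 1) / (32 * real n)))
                        (2 * (real V - 1) / (27 * real n))
               else (1 - 2 * L) / 6)))
       \<and> (V \<le> 13 * n \<longrightarrow> (\<exists>P \<in> distributions M.
            excess_risk G P n ghat \<ge> 1/8 * sqrt (real V / real n)))"
proof -
  obtain A where A: "A \<subseteq> space M" "finite A" "shatters G A" "card A = V"
    using vc_dim_attained[OF assms(4)] assms(5) by auto
  have ne: "A \<noteq> {}" using A(4) assms(5) by auto
  define m where "m = real V - 1"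
  have m: "m > 0" using assms(5) by (simp add: m_def)
  have card: "real (card A) = real V" "m = real (card A) - 1" using A(4) by (auto simp: m_def)
  have uniform: "\<exists>P \<in> distributions_with_inf_risk M G ((1 - \<xi>) / 2). excess_risk G P n ghat \<ge> b"
    if bounds: "0 \<le> \<xi>" "\<xi> \<le> 1"
      "b \<le> \<xi> / 2 * max ((1 - 1 / real V)^n) (1 - \<xi> * sqrt (real n / real V))" for \<xi> b
  proof -
    obtain P where P: "P \<in> distributions M" "(INF g\<in>G. risk P g) = (1 - \<xi>) / 2"
      "\<xi> / 2 * max ((1 - 1 / real V)^n) (1 - \<xi> * sqrt (real n / real V)) \<le> excess_risk G P n ghat"
      using uniform_lower_bound[OF A(2,1) ne bounds(1,2) assms(3) A(3) assms(6)] unfolding card by blast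
    show ?thesis
      by (rule bexI[of _ P]) (use P bounds(3) in \<open>auto simp: distributions_with_inf_risk_def\<close>)
  qed
  have heavy: "\<exists>P \<in> distributions_with_inf_risk M G K. excess_risk G P n ghat \<ge> b"
    if bounds: "0 \<le> w" "m * w \<le> 1" "0 \<le> \<xi>" "\<xi> \<le> 1" "0 \<le> \<zeta>" "\<zeta> \<le> 1/2"
      "K = m * (w * (1 - \<xi>) / 2) + (1 - m * w) * \<zeta>"
      "b \<le> m * w * \<xi> / 2 * max ((1 - w)^n) (1 - \<xi> * sqrt (real n * w))" for w \<xi> \<zeta> K b
  proof -
    obtain P where P: "P \<in> distributions M"
      "(INF g\<in>G. risk P g) = m * (w * (1 - \<xi>) / 2) + (1 - m * w) * \<zeta>"
      "m * w * \<xi> / 2 * max ((1 - w)^n) (1 - \<xi> * sqrt (real n * w)) \<le> excess_risk G P n ghat"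
      using heavy_point_lower_bound[OF A(2,1) ne card(2) bounds(1-6) assms(3) A(3) assms(6)] by blast
    show ?thesis
      by (rule bexI[of _ P]) (use P bounds(7,8) in \<open>auto simp: distributions_with_inf_risk_def\<close>)
  qed
  have noiseless: "\<exists>P \<in> distributions_with_inf_risk M G 0. excess_risk G P n ghat \<ge>
      (if real n \<ge> real V - 2 then (real V - 1) / (2 * exp 1 * (real n + 1))
       else 1/2 * (1 - 1 / real V) ^ n)"
  proof (cases "real n \<ge> real V - 2")
    case True
    \<comment> \<open>This weight maximises \<open>w * (1 - w)^n\<close>, and
      \<open>n \<ge> V - 2\<close> says exactly that \<open>m * w \<le> 1\<close>.\<close>
    let ?w = "1 / (real n + 1)"
    have "(real V - 1) / (2 * exp 1 * (real n + 1)) = m * ?w * 1 / 2 * exp (-1)"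
      by (simp add: m_def exp_minus field_simps)
    also have "\<dots> \<le> m * ?w * 1 / 2 * (1 - ?w)^n"
      using m by (intro mult_left_mono exp_minus_one_le_power) auto
    also have "\<dots> \<le> m * ?w * 1 / 2 * max ((1 - ?w)^n) (1 - 1 * sqrt (real n * ?w))"
      using m by (intro mult_left_mono) auto
    finally have b: "(real V - 1) / (2 * exp 1 * (real n + 1))
      \<le> m * ?w * 1 / 2 * max ((1 - ?w)^n) (1 - 1 * sqrt (real n * ?w))" .
    have "m * ?w \<le> 1" using True by (simp add: m_def)
    then show ?thesis using heavy[of ?w 1 0 0, OF _ _ _ _ _ _ _ b] True by simp
  next
    case False
    \<comment> \<open>That weight is now too large; the noise-free uniform model replaces
      it.\<close>
    then show ?thesis using uniform[of 1 "1/2 * (1 - 1 / real V) ^ n"] by simp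
  qed
  have noisy: "\<exists>P \<in> distributions_with_inf_risk M G L. excess_risk G P n ghat \<ge>
      (if (1 - 2 * L)\<^sup>2 * real n / real V \<ge> 4/9
       then max (sqrt (L * (real V - 1) / (32 * real n))) (2 * (real V - 1) / (27 * real n))
       else (1 - 2 * L) / 6)" if L: "0 < L" "L \<le> 1/2"
  proof (cases "(1 - 2 * L)\<^sup>2 * real n / real V \<ge> 4/9")
    case True
    have n: "real n > 0" using True by (cases "n = 0") auto
    have cond: "4/9 * real V \<le> (1 - 2 * L)\<^sup>2 * real n"
      using True assms(5) by (simp add: pos_le_divide_eq)
    have 1: "\<exists>P \<in> distributions_with_inf_risk M G L.
      excess_risk G P n ghat \<ge> sqrt (L * (real V - 1) / (32 * real n))"
    proof -
      have "m \<le> 4 * (1 - 2 * L)\<^sup>2 * real n" using cond by (simp add: m_def)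
      from noise_level_solution[OF L m n this] obtain w \<xi> where
        w: "0 \<le> w" "m * w \<le> 1" "0 \<le> \<xi>" "\<xi> \<le> 1" "m * (w * (1 - \<xi>) / 2) = L"
        and b: "sqrt (L * m / (32 * real n)) \<le> m * w * \<xi> / 2 * (1 - \<xi> * sqrt (real n * w))" .
      note b
      also have "\<dots> \<le> m * w * \<xi> / 2 * max ((1 - w)^n) (1 - \<xi> * sqrt (real n * w))"
        using m w by (intro mult_left_mono) auto
      finally show ?thesis
        \<comment> \<open>With \<open>\<zeta> = 0\<close> the light points carry all of the noise
          \<open>L\<close>.\<close>
        using w by (intro heavy[of w \<xi> 0]) (simp_all add: m_def)
    qed
    have 2: "\<exists>P \<in> distributions_with_inf_risk M G L.
      excess_risk G P n ghat \<ge> 2 * (real V - 1) / (27 * real n)"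
    proof -
      \<comment> \<open>Noise-free light points yield \<open>w * (1 - sqrt (n * w)) / 2\<close>
        each, maximal at \<open>sqrt (n * w) = 2/3\<close>. The heavy point carries all the noise,
        at rate \<open>L / (1 - m * w)\<close>, which is at most 1/2 because
        \<open>m * w \<le> 1 - 2 * L\<close>.\<close>
      define w where "w = 4 / (9 * real n)"
      have "w \<ge> 0" by (simp add: w_def)
      have "(1 - 2 * L) * (1 - 2 * L) \<le> 1 * (1 - 2 * L)"
        using L by (intro mult_right_mono) auto
      then have "(1 - 2 * L)\<^sup>2 * real n \<le> (1 - 2 * L) * real n"
        using n by (intro mult_right_mono) (auto simp: power2_eq_square)
      then have "4/9 * m \<le> (1 - 2 * L) * real n" using cond by (simp add: m_def)
      then have mw: "m * w \<le> 1 - 2 * L" using n by (simp add: w_def field_simps)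
      then have pos: "1 - m * w > 0" using L by linarith
      have "sqrt (real n * w) = sqrt ((2/3)\<^sup>2)"
        using n by (intro arg_cong[where f = sqrt]) (simp add: w_def power2_eq_square)
      then have root: "sqrt (real n * w) = 2/3" by (simp only: real_sqrt_abs)
      have "2 * (real V - 1) / (27 * real n) = m * w * 1 / 2 * (1 - 1 * sqrt (real n * w))"
        unfolding root using n by (simp add: m_def w_def field_simps)
      also have "\<dots> \<le> m * w * 1 / 2 * max ((1 - w)^n) (1 - 1 * sqrt (real n * w))"
        using m \<open>w \<ge> 0\<close> by (intro mult_left_mono) auto
      finally have b: "2 * (real V - 1) / (27 * real n)
        \<le> m * w * 1 / 2 * max ((1 - w)^n) (1 - 1 * sqrt (real n * w))" .
      show ?thesis
      proof (rule heavy[where \<zeta> = "L / (1 - m * w)", OF _ _ _ _ _ _ _ b])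
        show "L = m * (w * (1 - 1) / 2) + (1 - m * w) * (L / (1 - m * w))"
          using pos by simp
        show "m * w \<le> 1" using mw L by linarith
        show "0 \<le> L / (1 - m * w)" using pos L by (intro divide_nonneg_pos) auto
        have "L \<le> 1/2 * (1 - m * w)" using mw by simp
        then show "L / (1 - m * w) \<le> 1/2" by (subst pos_divide_le_eq[OF pos])
      qed (use \<open>w \<ge> 0\<close> in auto)
    qed
    show ?thesis using True 1 2 by (simp add: max_def)
  next
    case False
    \<comment> \<open>For \<open>\<xi> = 1 - 2 * L\<close> the failed condition bounds
      \<open>\<xi> * sqrt (n / V)\<close> by 2/3, so a factor of at least 1/3 is left.\<close>
    have "((1 - 2 * L) * sqrt (real n / real V))\<^sup>2 \<le> (2/3)\<^sup>2"
      using False by (simp add: power_mult_distrib) (simp add: power2_eq_square)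
    then have "(1 - 2 * L) * sqrt (real n / real V) \<le> 2/3"
      by (rule power2_le_imp_le) simp
    then have "(1 - 2 * L) / 2 * (1/3) \<le> (1 - 2 * L) / 2 *
        max ((1 - 1 / real V)^n) (1 - (1 - 2 * L) * sqrt (real n / real V))"
      using L by (intro mult_left_mono max.coboundedI2) auto
    then show ?thesis using uniform[of "1 - 2 * L" "(1 - 2 * L) / 6"] L False by simp
  qed
  have large: "\<exists>P \<in> distributions M. excess_risk G P n ghat \<ge> 1/8 * sqrt (real V / real n)"
    if V13: "V \<le> 13 * n"
  proof -
    define t where "t = real V / real n"
    have n: "real n > 0" using V13 assms(5) by (cases "n = 0") auto
    then have t: "t > 0" "t \<le> 13" using V13 assms(5) by (auto simp: t_def field_simps)
    have inv: "real n / real V = 1 / t" by (simp add: t_def)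
    have "\<exists>\<xi>. 0 \<le> \<xi> \<and> \<xi> \<le> 1 \<and>
      1/8 * sqrt t \<le> \<xi> / 2 * max ((1 - 1 / real V)^n) (1 - \<xi> * sqrt (real n / real V))"
    proof (cases "t \<le> 4")
      case True
      \<comment> \<open>With \<open>L\<close> free, this maximises
        \<open>\<xi> / 2 * (1 - \<xi> / sqrt t)\<close>; \<open>t \<le> 4\<close> keeps it at most
        1.\<close>
      define \<xi> where "\<xi> = sqrt t / 2"
      have "sqrt t \<le> sqrt (2\<^sup>2)" using True by (intro real_sqrt_le_mono) simp
      then have \<xi>: "0 \<le> \<xi>" "\<xi> \<le> 1" using t by (auto simp: \<xi>_def)
      have "\<xi> * sqrt (1 / t) = 1/2" using t by (simp add: \<xi>_def real_sqrt_divide)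
      then have "1/8 * sqrt t = \<xi> / 2 * (1 - \<xi> * sqrt (real n / real V))"
        by (simp add: inv) (simp add: \<xi>_def)
      also have "\<dots> \<le> \<xi> / 2 * max ((1 - 1 / real V)^n) (1 - \<xi> * sqrt (real n / real V))"
        using \<xi> by (intro mult_left_mono) auto
      finally show ?thesis using \<xi> by blast
    next
      case False
      \<comment> \<open>Here \<open>\<xi> = 1\<close>, and the probability of missing a point is
        used instead, by Bernoulli's inequality; this is where \<open>t \<le> 13\<close>
        enters.\<close>
      have "1 - 1 / t \<le> (1 - 1 / real V) ^ n"
        using Bernoulli_inequality[of "- (1 / real V)" n] assms(5) by (simp add: inv[symmetric])
      then have "1/2 * (1 - 1/t) \<le> 1/2 * max ((1 - 1 / real V)^n) (1 - 1 * sqrt (real n / real V))"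
        by (intro mult_left_mono max.coboundedI1) auto
      then show ?thesis
        using sqrt_le_of_intermediate_ratio[of t] False t by (intro exI[of _ 1]) auto
    qed
    then show ?thesis
      using uniform unfolding t_def distributions_with_inf_risk_def by blast
  qed
  show ?thesis using noiseless noisy large by blast
qed

end
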